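(* Let $A\in\mathbb{R}^{n\times n}$ be symmetric positive definite, let $M\in\mathbb{R}^{n\times n}$ be such that $M+M^T-A$ is symmetric positive definite, and let $\widetilde{M}=M(M+M^T-A)^{-1}M^T$. Let $\lambda_1\le\cdots\le\lambda_n$ and $\mathbf{v}_1,\dots,\mathbf{v}_n$ be the eigenvalues and $\widetilde{M}$-orthonormal eigenvectors of $A\mathbf{x}=\lambda\widetilde{M}\mathbf{x}$, and let $P_\sharp=\begin{pmatrix}\mathbf{v}_1&\cdots&\mathbf{v}_{n_c}\end{pmatrix}$. Suppose the rows of $P_\sharp$ are ordered according to a splitting $F\cup C$ of $\{1,\dots,n\}$ with $|C|=n_c$, so that $$P_\sharp=\begin{bmatrix} P_f \\ P_c \end{bmatrix},$$ and suppose $P_c$ is nonsingular. Then the interpolation matrix $$\bar P_\sharp=P_\sharp P_c^{-1}=\begin{bmatrix} \bar W \\ I \end{bmatrix},\qquad \bar W=P_fP_c^{-1},$$ minimizes $\sup_{\mathbf{v}\neq0}\kappa(P,\mathbf{v})$ over all full rank matrices $P\in\mathbb{R}^{n\times n_c}$.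
   Context: Here $1\le n_c<n$. For full rank $P\in\mathbb{R}^{n\times n_c}$, $$\kappa(P,\mathbf{v})=\frac{\|(I-\Pi_{\widetilde{M}}(P))\mathbf{v}\|_{\widetilde{M}}^2}{\|\mathbf{v}\|_A^2},$$ where $\Pi_{\widetilde{M}}(P)=P(P^T\widetilde{M}P)^{-1}P^T\widetilde{M}$ is the $\widetilde{M}$-orthogonal projection onto $\operatorname{range}(P)$ and $\|\mathbf{v}\|_X^2=\mathbf{v}^TX\mathbf{v}$ for symmetric positive definite $X$. $\widetilde{M}$-orthonormal means $\mathbf{v}_i^T\widetilde{M}\mathbf{v}_j=\delta_{ij}$. *)

theory Defs
  imports
    "Jordan_Normal_Form.Gauss_Jordan_Elimination"
    "Jordan_Normal_Form.DL_Rank"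
    "Jordan_Normal_Form.DL_Submatrix"
    "HOL-Library.Extended_Real"
begin

(* All indices are 0-based: the mathematical index i in {1..n} is i - 1 here. *)

(* Meaningful for nonsingular matrices only; see mat_inv_correct. *)
definition mat_inv :: "real mat \<Rightarrow> real mat" where
  "mat_inv X = the (mat_inverse X)"

lemma mat_inv_correct:
  assumes X: "X \<in> carrier_mat n n" and inv: "invertible_mat X"
  shows "mat_inv X \<in> carrier_mat n n" "X * mat_inv X = 1\<^sub>m n" "mat_inv X * X = 1\<^sub>m n"
proof -
  obtain B where B: "X * B = 1\<^sub>m n" "B * X = 1\<^sub>m (dim_row B)"
    using inv X unfolding invertible_mat_def inverts_mat_def by auto
  have "dim_col B = n" "dim_row B = n"
    using arg_cong[OF B(1), of dim_col] arg_cong[OF B(2), of dim_col] X by auto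
  then have "X \<in> Units (ring_mat TYPE(real) n ())"
    using X B unfolding Units_def ring_mat_def by auto
  then obtain C where "mat_inverse X = Some C"
    using mat_inverse(1)[OF X, of "()"] by (cases "mat_inverse X") auto
  then show "mat_inv X \<in> carrier_mat n n" "X * mat_inv X = 1\<^sub>m n" "mat_inv X * X = 1\<^sub>m n"
    using mat_inverse(2)[OF X] unfolding mat_inv_def by auto
qed

definition spd_mat :: "nat \<Rightarrow> real mat \<Rightarrow> bool" where
  "spd_mat n X \<longleftrightarrow> X \<in> carrier_mat n n \<and> X\<^sup>T = X \<and>
     (\<forall>v \<in> carrier_vec n. v \<noteq> 0\<^sub>v n \<longrightarrow> v \<bullet> (X *\<^sub>v v) > 0)"

definition sq_norm_wrt :: "real mat \<Rightarrow> real vec \<Rightarrow> real" where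
  "sq_norm_wrt X v = v \<bullet> (X *\<^sub>v v)"

definition M_tilde :: "real mat \<Rightarrow> real mat \<Rightarrow> real mat" where
  "M_tilde A M = M * mat_inv (M + M\<^sup>T - A) * M\<^sup>T"

definition full_rank :: "nat \<Rightarrow> nat \<Rightarrow> real mat \<Rightarrow> bool" where
  "full_rank n n\<^sub>c P \<longleftrightarrow> P \<in> carrier_mat n n\<^sub>c \<and> vec_space.rank n P = min n n\<^sub>c"

definition proj_wrt :: "real mat \<Rightarrow> real mat \<Rightarrow> real mat" where
  "proj_wrt X P = P * mat_inv (P\<^sup>T * X * P) * P\<^sup>T * X"

definition kappa :: "real mat \<Rightarrow> real mat \<Rightarrow> real mat \<Rightarrow> real vec \<Rightarrow> real" where
  "kappa A X P v =
     sq_norm_wrt X ((1\<^sub>m (dim_row P) - proj_wrt X P) *\<^sub>v v) / sq_norm_wrt A v"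

(* Taken in the extended reals, so that the supremum is meaningful without a
   separate boundedness argument. *)
definition sup_kappa :: "real mat \<Rightarrow> real mat \<Rightarrow> real mat \<Rightarrow> ereal" where
  "sup_kappa A X P =
     (SUP v \<in> carrier_vec (dim_row P) - {0\<^sub>v (dim_row P)}. ereal (kappa A X P v))"

(* submatrix lists the selected rows in increasing order of their indices. *)
abbreviation select_rows :: "nat set \<Rightarrow> real mat \<Rightarrow> real mat" where
  "select_rows I P \<equiv> submatrix P I UNIV"

(* P with its rows reordered: first the rows in F, then the rows in C. If
   F = {0..<m} and C = {m..<n} this is P itself. *)
definition FC_order :: "nat set \<Rightarrow> nat set \<Rightarrow> real mat \<Rightarrow> real mat" where
  "FC_order F C P = select_rows F P @\<^sub>r select_rows C P"

end

theory Submission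
  imports Defs "Jordan_Normal_Form.DL_Rank_Submatrix"
begin

text \<open>
  Write \<open>\<parallel>\<cdot>\<parallel>\<^sub>A\<close> and \<open>\<parallel>\<cdot>\<parallel>\<^sub>X\<close> for the norms, with \<open>X\<close> the matrix \<open>Mt\<close>. In the coordinates \<open>x\<close> of
  the eigenbasis both quadratic forms are diagonal: for \<open>w = V x\<close> we have
  \<open>\<parallel>w\<parallel>\<^sub>X\<^sup>2 = \<Sum>i. x\<^sub>i\<^sup>2\<close> and \<open>\<parallel>w\<parallel>\<^sub>A\<^sup>2 = \<Sum>i. lam i * x\<^sub>i\<^sup>2\<close>. This turns the theorem into a min-max
  statement in the style of Courant and Fischer, whose optimal value is \<open>1 / lam k\<close>. Here \<open>k\<close> is
  the number of columns of \<open>P\<close>, so that counting from zero \<open>lam k\<close> is the smallest eigenvalue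
  whose eigenvector is not interpolated.

  No \<open>P\<close> can do better (\<open>sup_kappa_lower\<close>): \<open>X\<close>-orthogonality to the range of \<open>P\<close> is a
  system of \<open>k\<close> linear equations, so it has a nonzero solution \<open>w\<close> in the span of the \<open>k + 1\<close>
  eigenvectors \<open>v 0, \<dots>, v k\<close>. The projection sends this \<open>w\<close> to zero, whence \<open>kappa\<close> at \<open>w\<close> is
  \<open>\<parallel>w\<parallel>\<^sub>X\<^sup>2 / \<parallel>w\<parallel>\<^sub>A\<^sup>2 \<ge> 1 / lam k\<close>.

  The value is attained when the range of \<open>P\<close> is the span of \<open>v 0, \<dots>, v (k - 1)\<close>
  (\<open>sup_kappa_upper\<close>): then the projection error of \<open>V x\<close> is the part of the expansion with
  indices at least \<open>k\<close>, and \<open>lam k * x\<^sub>i\<^sup>2 \<le> lam i * x\<^sub>i\<^sup>2\<close> for these indices. Multiplication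
  by the inverse of the coarse block on the right leaves the range unchanged and makes the coarse
  rows the identity, which also shows full rank.

  Positive definiteness of \<open>X\<close> is read off from the eigenvectors: \<open>n\<close> vectors orthonormal with
  respect to \<open>X\<close> form a basis in whose coordinates \<open>X\<close> is the standard inner product
  (\<open>surj_V\<close>, \<open>X_pos\<close>).
\<close>

section \<open>Row selection\<close>

lemma select_rows_index:
  assumes "i < card {a. a < dim_row B \<and> a \<in> I}" "j < dim_col B"
  shows "select_rows I B $$ (i, j) = B $$ (pick I i, j)"
  using submatrix_index[OF assms(1), of j UNIV] assms(2) by (simp add: pick_UNIV)

lemma select_rows_mult:
  assumes A: "A \<in> carrier_mat n k" and B: "B \<in> carrier_mat k m"
  shows "select_rows I (A * B) = select_rows I A * B"
proof (rule eq_matI)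
  have A_dim: "dim_row A = n" "dim_col A = k" using A by auto
  have B_dim: "dim_row B = k" "dim_col B = m" using B by auto
  fix i j
  assume "i < dim_row (select_rows I A * B)" "j < dim_col (select_rows I A * B)"
  then have i: "i < card {a. a < n \<and> a \<in> I}" and j: "j < m"
    by (simp_all add: dim_submatrix A_dim B_dim)
  have p: "pick I i < n" using pick_le[OF i] .
  have r: "row (select_rows I A) i = row A (pick I i)"
    by (rule eq_vecI) (use i in \<open>simp_all add: dim_submatrix select_rows_index A_dim p\<close>)
  have "select_rows I (A * B) $$ (i, j) = (A * B) $$ (pick I i, j)"
    by (rule select_rows_index) (simp_all only: index_mult_mat A_dim B_dim i j)
  also have "\<dots> = row A (pick I i) \<bullet> col B j" by (simp add: A_dim B_dim p j)
  also have "\<dots> = (select_rows I A * B) $$ (i, j)"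
    using i j by (simp add: r[symmetric] dim_submatrix A_dim B_dim)
  finally show "select_rows I (A * B) $$ (i, j) = (select_rows I A * B) $$ (i, j)" .
qed (simp_all add: dim_submatrix)

section \<open>Full rank and weighted projections\<close>

text \<open>
  The rank is the dimension of the span of the set of columns, and independence of this set means a
  trivial kernel only when no column is repeated. Full rank excludes repetitions: a maximal
  independent subset of the columns has as many elements as there are columns.
\<close>

lemma full_rank_inj:
  assumes P: "full_rank n k P" and kn: "k \<le> n"
    and y: "y \<in> carrier_vec k" and Py: "P *\<^sub>v y = 0\<^sub>v n"
  shows "y = 0\<^sub>v k"
proof -
  interpret vec_space "TYPE(real)" n .
  have Pc: "P \<in> carrier_mat n k" and r: "rank P = k"
    using P kn by (auto simp: full_rank_def)
  obtain S where S: "maximal S (\<lambda>T. T \<subseteq> set (cols P) \<and> lin_indpt T)"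
    using maximal_exists_superset[of "set (cols P)" "\<lambda>T. T \<subseteq> set (cols P) \<and> lin_indpt T" "{}"]
    by (auto simp: lin_dep_def)
  have "k = card S" using rank_card_indpt[OF Pc S] r by simp
  also have "\<dots> \<le> card (set (cols P))"
    using S by (intro card_mono) (auto simp: maximal_def)
  finally have "distinct (cols P)"
    using card_length[of "cols P"] Pc by (intro card_distinct) auto
  then show ?thesis
    using lin_depI[OF Pc y _ Py] full_rank_lin_indpt[OF Pc r] by blast
qed

lemma det_nonzero_invertible_mat:
  fixes X :: "'a :: field mat"
  assumes X: "X \<in> carrier_mat n n" and "det X \<noteq> 0"
  shows "invertible_mat X"
proof -
  obtain B where "B \<in> carrier_mat n n" "B * X = 1\<^sub>m n" "X * B = 1\<^sub>m n"
    using det_non_zero_imp_unit[OF assms, of "()"] by (auto simp: Units_def ring_mat_def)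
  then show ?thesis using X
    unfolding invertible_mat_def inverts_mat_def by auto
qed

lemma gram_mat_carrier:
  assumes P: "P \<in> carrier_mat n k" and X: "X \<in> carrier_mat n n"
  shows "P\<^sup>T * X * P \<in> carrier_mat k k"
  by (rule mult_carrier_mat[OF mult_carrier_mat[OF transpose_carrier_mat[THEN iffD2, OF P] X] P])

lemma gram_mat_mult_vec:
  fixes X :: "'a :: comm_semiring_0 mat"
  assumes P: "P \<in> carrier_mat n k" and X: "X \<in> carrier_mat n n" and y: "y \<in> carrier_vec k"
  shows "(P\<^sup>T * X * P) *\<^sub>v y = P\<^sup>T *\<^sub>v (X *\<^sub>v (P *\<^sub>v y))"
proof -
  have T: "P\<^sup>T \<in> carrier_mat k n" using P by simp
  have Py: "P *\<^sub>v y \<in> carrier_vec n" using P y by simp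
  show ?thesis
    using assoc_mult_mat_vec[OF mult_carrier_mat[OF T X] P y] assoc_mult_mat_vec[OF T X Py] by simp
qed

lemma mult_mat_zero_vec:
  fixes Y :: "'a :: comm_semiring_0 mat"
  assumes Y: "Y \<in> carrier_mat m k"
  shows "Y *\<^sub>v 0\<^sub>v k = 0\<^sub>v m"
proof (rule eq_vecI)
  fix i assume "i < dim_vec (0\<^sub>v m :: 'a vec)"
  then show "(Y *\<^sub>v 0\<^sub>v k) $ i = (0\<^sub>v m :: 'a vec) $ i"
    using Y scalar_prod_right_zero[of "row Y i" k] by simp
qed (use Y in simp)

text \<open>
  If \<open>y\<close> is in the kernel of \<open>P\<^sup>T X P\<close>, then the quadratic form of \<open>X\<close> vanishes at \<open>P y\<close>, so
  \<open>P y = 0\<close> by definiteness. This makes the inverse in \<open>proj_wrt\<close> a genuine one.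
\<close>

lemma invertible_gram_mat:
  assumes X: "X \<in> carrier_mat n n"
    and pos: "\<And>w. w \<in> carrier_vec n \<Longrightarrow> w \<noteq> 0\<^sub>v n \<Longrightarrow> w \<bullet> (X *\<^sub>v w) > 0"
    and P: "full_rank n k P" and kn: "k \<le> n"
  shows "invertible_mat (P\<^sup>T * X * P)"
proof (rule det_nonzero_invertible_mat)
  have Pc[simp]: "P \<in> carrier_mat n k" using P by (simp add: full_rank_def)
  note X[simp]
  show G: "P\<^sup>T * X * P \<in> carrier_mat k k" by (rule gram_mat_carrier[OF Pc X])
  show "det (P\<^sup>T * X * P) \<noteq> 0"
  proof
    assume "det (P\<^sup>T * X * P) = 0"
    then obtain y where y[simp]: "y \<in> carrier_vec k" and y0: "y \<noteq> 0\<^sub>v k"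
      and Gy: "(P\<^sup>T * X * P) *\<^sub>v y = 0\<^sub>v k"
      using det_0_iff_vec_prod_zero_field[OF G] by auto
    have "(P *\<^sub>v y) \<bullet> (X *\<^sub>v (P *\<^sub>v y)) = (P\<^sup>T *\<^sub>v (X *\<^sub>v (P *\<^sub>v y))) \<bullet> y"
      using transpose_vec_mult_scalar[OF Pc y, of "X *\<^sub>v (P *\<^sub>v y)"]
      by (metis Pc X comm_scalar_prod mult_mat_vec_carrier y)
    also have "P\<^sup>T *\<^sub>v (X *\<^sub>v (P *\<^sub>v y)) = (P\<^sup>T * X * P) *\<^sub>v y"
      by (rule gram_mat_mult_vec[OF Pc X y, symmetric])
    finally have "(P *\<^sub>v y) \<bullet> (X *\<^sub>v (P *\<^sub>v y)) = 0" by (simp add: Gy)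
    then have "P *\<^sub>v y = 0\<^sub>v n" using pos[OF mult_mat_vec_carrier[OF Pc y]] by auto
    then show False using full_rank_inj[OF P kn y] y0 by simp
  qed
qed

lemma proj_wrt_mult_vec:
  assumes X: "X \<in> carrier_mat n n" and P: "P \<in> carrier_mat n k"
    and inv: "invertible_mat (P\<^sup>T * X * P)" and w: "w \<in> carrier_vec n"
  shows "proj_wrt X P *\<^sub>v w = P *\<^sub>v (mat_inv (P\<^sup>T * X * P) *\<^sub>v (P\<^sup>T *\<^sub>v (X *\<^sub>v w)))"
    and "proj_wrt X P \<in> carrier_mat n n"
proof -
  let ?K = "mat_inv (P\<^sup>T * X * P)"
  have K: "?K \<in> carrier_mat k k" by (rule mat_inv_correct(1)[OF gram_mat_carrier[OF P X] inv])
  have T: "P\<^sup>T \<in> carrier_mat k n" using P by simp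
  have Xw: "X *\<^sub>v w \<in> carrier_vec n" using X w by simp
  have TXw: "P\<^sup>T *\<^sub>v (X *\<^sub>v w) \<in> carrier_vec k" by (rule mult_mat_vec_carrier[OF T Xw])
  note PK = mult_carrier_mat[OF P K] and PKT = mult_carrier_mat[OF mult_carrier_mat[OF P K] T]
  show "proj_wrt X P *\<^sub>v w = P *\<^sub>v (?K *\<^sub>v (P\<^sup>T *\<^sub>v (X *\<^sub>v w)))"
    unfolding proj_wrt_def assoc_mult_mat_vec[OF PKT X w] assoc_mult_mat_vec[OF PK T Xw]
      assoc_mult_mat_vec[OF P K TXw] ..
  show "proj_wrt X P \<in> carrier_mat n n"
    unfolding proj_wrt_def by (rule mult_carrier_mat[OF PKT X])
qed

lemma proj_wrt_range:
  assumes X: "X \<in> carrier_mat n n" and P: "P \<in> carrier_mat n k"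
    and inv: "invertible_mat (P\<^sup>T * X * P)" and y: "y \<in> carrier_vec k"
  shows "proj_wrt X P *\<^sub>v (P *\<^sub>v y) = P *\<^sub>v y"
proof -
  let ?G = "P\<^sup>T * X * P"
  have G: "?G \<in> carrier_mat k k" by (rule gram_mat_carrier[OF P X])
  note mi = mat_inv_correct[OF G inv]
  have "P\<^sup>T *\<^sub>v (X *\<^sub>v (P *\<^sub>v y)) = ?G *\<^sub>v y"
    by (rule gram_mat_mult_vec[OF P X y, symmetric])
  moreover have "mat_inv ?G *\<^sub>v (?G *\<^sub>v y) = y"
    using assoc_mult_mat_vec[OF mi(1) G y] mi(3) y by simp
  ultimately show ?thesis
    using proj_wrt_mult_vec(1)[OF X P inv, of "P *\<^sub>v y"] P y by simp
qed

lemma proj_wrt_orthogonal: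
  assumes X: "X \<in> carrier_mat n n" and P: "P \<in> carrier_mat n k"
    and inv: "invertible_mat (P\<^sup>T * X * P)" and w: "w \<in> carrier_vec n"
    and orth: "P\<^sup>T *\<^sub>v (X *\<^sub>v w) = 0\<^sub>v k"
  shows "proj_wrt X P *\<^sub>v w = 0\<^sub>v n"
proof -
  have "mat_inv (P\<^sup>T * X * P) \<in> carrier_mat k k"
    by (rule mat_inv_correct(1)[OF gram_mat_carrier[OF P X] inv])
  then show ?thesis using proj_wrt_mult_vec(1)[OF X P inv w] orth P
    by (simp add: mult_mat_zero_vec)
qed

text \<open>
  The solution uses only the first \<open>k + 1\<close> unknowns: \<open>k\<close> equations cannot force all of these to
  vanish. To obtain it from the determinant criterion for square matrices, the system is completed
  by a zero row, which makes it singular, and by rows that set the remaining unknowns to zero.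
\<close>

lemma underdetermined_kernel:
  fixes B :: "'a :: field mat"
  assumes B: "B \<in> carrier_mat k n" and kn: "k < n"
  obtains x where "x \<in> carrier_vec n" "x \<noteq> 0\<^sub>v n" "B *\<^sub>v x = 0\<^sub>v k"
    "\<And>i. k < i \<Longrightarrow> i < n \<Longrightarrow> x $ i = 0"
proof -
  define S where "S = mat n n (\<lambda>(i, j). if i < k then B $$ (i, j) else if k < i \<and> i = j then 1 else 0)"
  have S: "S \<in> carrier_mat n n" by (simp add: S_def)
  have "S\<^sup>T *\<^sub>v unit_vec n k = 0\<^sub>v n"
    using kn by (intro eq_vecI) (auto simp: S_def)
  moreover have "unit_vec n k \<noteq> (0\<^sub>v n :: 'a vec)" using kn by simp
  ultimately have "det S\<^sup>T = 0"
    using det_0_iff_vec_prod_zero_field[OF transpose_carrier_mat[THEN iffD2, OF S]]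
      unit_vec_carrier[of n k] by blast
  then have "det S = 0" using det_transpose[OF S] by simp
  then obtain x where x: "x \<in> carrier_vec n" "x \<noteq> 0\<^sub>v n" and Sx: "S *\<^sub>v x = 0\<^sub>v n"
    using det_0_iff_vec_prod_zero_field[OF S] by auto
  have Sxi: "row S i \<bullet> x = 0" if "i < n" for i
    using arg_cong[OF Sx, of "\<lambda>u. u $ i"] that S by simp
  have "row B i = row S i" if "i < k" for i
    using that kn B by (intro eq_vecI) (auto simp: S_def)
  then have "B *\<^sub>v x = 0\<^sub>v k"
    using B Sxi kn by (intro eq_vecI) auto
  moreover have "x $ i = 0" if "k < i" "i < n" for i
  proof -
    have "row S i = unit_vec n i" using that by (auto simp: S_def unit_vec_def)
    then show ?thesis using Sxi[OF that(2)] x that by simp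
  qed
  ultimately show thesis using that x by blast
qed

section \<open>Coordinates in a generalized eigenbasis\<close>

locale generalized_eigenbasis =
  fixes n :: nat and A X :: "real mat" and lam :: "nat \<Rightarrow> real" and v :: "nat \<Rightarrow> real vec"
  assumes A: "A \<in> carrier_mat n n" and X: "X \<in> carrier_mat n n"
    and v: "\<And>i. i < n \<Longrightarrow> v i \<in> carrier_vec n"
    and eigen: "\<And>i. i < n \<Longrightarrow> A *\<^sub>v v i = lam i \<cdot>\<^sub>v (X *\<^sub>v v i)"
    and orthonormal: "\<And>i j. i < n \<Longrightarrow> j < n \<Longrightarrow> v i \<bullet> (X *\<^sub>v v j) = (if i = j then 1 else 0)"
begin

definition V :: "real mat" where "V = mat_of_cols n (map v [0..<n])"

lemma V: "V \<in> carrier_mat n n"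
  using mat_of_cols_carrier(1)[of n "map v [0..<n]"] by (simp add: V_def)

lemma col_V: "i < n \<Longrightarrow> col V i = v i"
  using v by (simp add: V_def)

lemma gram_V: "V\<^sup>T * (X * V) = 1\<^sub>m n"
proof (rule eq_matI)
  fix i j assume "i < dim_row (1\<^sub>m n :: real mat)" "j < dim_col (1\<^sub>m n :: real mat)"
  then show "(V\<^sup>T * (X * V)) $$ (i, j) = 1\<^sub>m n $$ (i, j)"
    using V X col_mult2[OF X V, of j] by (simp add: col_V orthonormal)
qed (use V X in auto)

lemma gram_V_A: "V\<^sup>T * (A * V) = mat_diag n lam"
proof (rule eq_matI)
  fix i j assume "i < dim_row (mat_diag n lam)" "j < dim_col (mat_diag n lam)"
  then have ij: "i < n" "j < n" by (auto simp: mat_diag_def)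
  then show "(V\<^sup>T * (A * V)) $$ (i, j) = mat_diag n lam $$ (i, j)"
    using V A X v col_mult2[OF A V, of j]
    by (simp add: col_V eigen orthonormal mat_diag_def scalar_prod_smult_right)
qed (use V A in \<open>auto simp: mat_diag_def\<close>)

text \<open>
  The Gram identity exhibits \<open>V\<^sup>T X\<close> as a left inverse of the square matrix \<open>V\<close>, hence as a right
  inverse: the eigenvectors span the space.
\<close>

lemma surj_V:
  assumes "w \<in> carrier_vec n"
  obtains x where "x \<in> carrier_vec n" "w = V *\<^sub>v x"
proof -
  have c: "V\<^sup>T * X \<in> carrier_mat n n" using V X by simp
  have "(V\<^sup>T * X) * V = 1\<^sub>m n" using gram_V V X by (simp add: assoc_mult_mat[of _ n n _ n _ n])
  then have "V * (V\<^sup>T * X) = 1\<^sub>m n" using mat_mult_left_right_inverse[OF c V] by simp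
  then have "w = V *\<^sub>v ((V\<^sup>T * X) *\<^sub>v w)"
    using assoc_mult_mat_vec[OF V c assms] assms by simp
  then show thesis using that[of "(V\<^sup>T * X) *\<^sub>v w"] c assms by simp
qed

lemma sq_norm_wrt_V:
  assumes Y: "Y \<in> carrier_mat n n" and x: "x \<in> carrier_vec n"
  shows "sq_norm_wrt Y (V *\<^sub>v x) = x \<bullet> ((V\<^sup>T * (Y * V)) *\<^sub>v x)"
proof -
  have u: "Y *\<^sub>v (V *\<^sub>v x) \<in> carrier_vec n" using Y V x by simp
  have "(V\<^sup>T * (Y * V)) *\<^sub>v x = V\<^sup>T *\<^sub>v (Y *\<^sub>v (V *\<^sub>v x))"
    using V Y x by (simp add: assoc_mult_mat_vec[of _ n n _ n])
  then show ?thesis unfolding sq_norm_wrt_def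
    using transpose_vec_mult_scalar[OF V x u] V x u
    by (metis comm_scalar_prod mult_mat_vec_carrier transpose_carrier_mat)
qed

lemma sq_norm_X:
  assumes "x \<in> carrier_vec n"
  shows "sq_norm_wrt X (V *\<^sub>v x) = (\<Sum>i<n. (x $ i)\<^sup>2)"
  using assms by (simp add: sq_norm_wrt_V[OF X] gram_V scalar_prod_def power2_eq_square lessThan_atLeast0)

lemma sq_norm_A:
  assumes "x \<in> carrier_vec n"
  shows "sq_norm_wrt A (V *\<^sub>v x) = (\<Sum>i<n. lam i * (x $ i)\<^sup>2)"
proof -
  have "mat_diag n lam *\<^sub>v x = vec n (\<lambda>i. lam i * x $ i)"
  proof (rule eq_vecI)
    fix i assume "i < dim_vec (vec n (\<lambda>i. lam i * x $ i))"
    then have i: "i < n" by simp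
    then have "row (mat_diag n lam) i = lam i \<cdot>\<^sub>v unit_vec n i"
      by (auto simp: mat_diag_def)
    then show "(mat_diag n lam *\<^sub>v x) $ i = vec n (\<lambda>i. lam i * x $ i) $ i"
      using i assms by (simp add: mat_diag_def)
  qed (simp add: mat_diag_def)
  then show ?thesis using assms
    by (simp add: sq_norm_wrt_V[OF A] gram_V_A scalar_prod_def power2_eq_square
        lessThan_atLeast0 ac_simps)
qed

lemma X_pos:
  assumes w: "w \<in> carrier_vec n" and w0: "w \<noteq> 0\<^sub>v n"
  shows "w \<bullet> (X *\<^sub>v w) > 0"
proof -
  obtain x where x: "x \<in> carrier_vec n" and wx: "w = V *\<^sub>v x" using surj_V[OF w] .
  have "x \<noteq> 0\<^sub>v n" using w0 V by (auto simp: wx)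
  then obtain i where i: "i < n" "x $ i \<noteq> 0" using x by (metis eq_vecI carrier_vecD index_zero_vec)
  have "0 < (\<Sum>i<n. (x $ i)\<^sup>2)" using i by (intro sum_pos2[of _ i]) auto
  then show ?thesis using sq_norm_X[OF x] by (simp add: wx sq_norm_wrt_def)
qed

end

section \<open>Min-max bounds for the projection error\<close>

locale pos_generalized_eigenbasis = generalized_eigenbasis +
  assumes A_pos: "\<And>w. w \<in> carrier_vec n \<Longrightarrow> w \<noteq> 0\<^sub>v n \<Longrightarrow> w \<bullet> (A *\<^sub>v w) > 0"
    and mono: "\<And>i j. i \<le> j \<Longrightarrow> j < n \<Longrightarrow> lam i \<le> lam j"
begin

lemma lam_pos:
  assumes i: "i < n"
  shows "lam i > 0"
proof -
  have "v i \<noteq> 0\<^sub>v n" using orthonormal[OF i i] X v[OF i] by auto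
  then have "v i \<bullet> (A *\<^sub>v v i) > 0" using A_pos v i by blast
  then show ?thesis using v[OF i] X i
    by (simp add: eigen orthonormal scalar_prod_smult_right)
qed

text \<open>
  The witness is a vector in the span of \<open>v 0, \<dots>, v k\<close> that is \<open>X\<close>-orthogonal to the range of
  \<open>P\<close>: the projection gives no reduction there, and on this span the Rayleigh quotient of \<open>A\<close>
  with respect to \<open>X\<close> is at most \<open>lam k\<close>.
\<close>

lemma sup_kappa_lower:
  assumes P: "full_rank n k P" and kn: "k < n"
  shows "ereal (1 / lam k) \<le> sup_kappa A X P"
proof -
  have Pc: "P \<in> carrier_mat n k" using P by (simp add: full_rank_def)
  have inv: "invertible_mat (P\<^sup>T * X * P)"
    using invertible_gram_mat[OF X X_pos P] kn by simp
  have "P\<^sup>T * (X * V) \<in> carrier_mat k n" using Pc X V by simp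
  then obtain x where x: "x \<in> carrier_vec n" "x \<noteq> 0\<^sub>v n"
    and Bx: "(P\<^sup>T * (X * V)) *\<^sub>v x = 0\<^sub>v k" and tail: "\<And>i. k < i \<Longrightarrow> i < n \<Longrightarrow> x $ i = 0"
    using underdetermined_kernel kn by blast
  let ?w = "V *\<^sub>v x"
  obtain i where i: "i < n" "x $ i \<noteq> 0" using x by (metis eq_vecI carrier_vecD index_zero_vec)
  have pos: "0 < (\<Sum>i<n. (x $ i)\<^sup>2)" using i by (intro sum_pos2[of _ i]) auto
  have w: "?w \<in> carrier_vec n" using V x by simp
  have w0: "?w \<noteq> 0\<^sub>v n" using sq_norm_X[OF x(1)] pos X by (auto simp: sq_norm_wrt_def)
  have "P\<^sup>T *\<^sub>v (X *\<^sub>v ?w) = 0\<^sub>v k"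
    using Bx Pc X V x by (simp add: assoc_mult_mat_vec[of _ n n _ n] assoc_mult_mat_vec[of _ k n _ n])
  then have "(1\<^sub>m n - proj_wrt X P) *\<^sub>v ?w = ?w"
    using proj_wrt_orthogonal[OF X Pc inv w] proj_wrt_mult_vec(2)[OF X Pc inv w] w
    by (simp add: minus_mult_distrib_mat_vec[of _ n n])
  then have kap: "kappa A X P ?w = (\<Sum>i<n. (x $ i)\<^sup>2) / (\<Sum>i<n. lam i * (x $ i)\<^sup>2)"
    using Pc x by (simp add: kappa_def sq_norm_X sq_norm_A)
  have "lam i * (x $ i)\<^sup>2 \<le> lam k * (x $ i)\<^sup>2" if "i < n" for i
    using mono[of i k] tail[of i] that kn by (cases "i \<le> k") (auto intro: mult_right_mono)
  then have le: "(\<Sum>i<n. lam i * (x $ i)\<^sup>2) \<le> lam k * (\<Sum>i<n. (x $ i)\<^sup>2)"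
    unfolding sum_distrib_left by (intro sum_mono) auto
  have "0 < (\<Sum>i<n. lam i * (x $ i)\<^sup>2)"
    using A_pos[OF w w0] sq_norm_A[OF x(1)] by (simp add: sq_norm_wrt_def)
  then have "1 / lam k \<le> kappa A X P ?w"
    using le lam_pos[OF kn] by (simp add: kap field_simps)
  then show ?thesis unfolding sup_kappa_def
    using w w0 Pc by (intro SUP_upper2[of ?w]) auto
qed

text \<open>
  The two factorizations say that \<open>P\<close> and the matrix of the first \<open>k\<close> eigenvectors have the same
  range. The first one gives orthogonality of \<open>P\<close> to the other eigenvectors, the second one shows
  that the projection fixes the first \<open>k\<close> eigenvectors.
\<close>

lemma sup_kappa_upper:
  assumes P: "full_rank n k P" and kn: "k < n"
    and Q: "Q \<in> carrier_mat k k" and R: "R \<in> carrier_mat k k"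
    and P_eq: "P = mat_of_cols n (map v [0..<k]) * Q"
    and S_eq: "mat_of_cols n (map v [0..<k]) = P * R"
  shows "sup_kappa A X P \<le> ereal (1 / lam k)"
proof -
  let ?S = "mat_of_cols n (map v [0..<k])"
  have S: "?S \<in> carrier_mat n k" by auto
  have Pc: "P \<in> carrier_mat n k" using P by (simp add: full_rank_def)
  have inv: "invertible_mat (P\<^sup>T * X * P)"
    using invertible_gram_mat[OF X X_pos P] kn by simp
  have bound: "kappa A X P w \<le> 1 / lam k" if w: "w \<in> carrier_vec n" and w0: "w \<noteq> 0\<^sub>v n" for w
  proof -
    obtain x where x: "x \<in> carrier_vec n" and wx: "w = V *\<^sub>v x" using surj_V[OF w] .
    \<comment> \<open>\<open>y\<close> holds the coordinates that the projection reproduces, \<open>z\<close> those that it removes.\<close>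
    define y z where "y = vec k (\<lambda>i. x $ i)" and "z = vec n (\<lambda>i. if i < k then 0 else x $ i)"
    have y: "y \<in> carrier_vec k" and z: "z \<in> carrier_vec n" by (auto simp: y_def z_def)
    have Vz: "V *\<^sub>v z \<in> carrier_vec n" using V z by simp
    have Ry: "R *\<^sub>v y \<in> carrier_vec k" using R y by simp
    have split: "w = P *\<^sub>v (R *\<^sub>v y) + V *\<^sub>v z"
    proof (rule eq_vecI)
      fix i assume "i < dim_vec (P *\<^sub>v (R *\<^sub>v y) + V *\<^sub>v z)"
      then have i: "i < n" using V by simp
      have "w $ i = (\<Sum>j\<in>{0..<n}. v j $ i * x $ j)"
        using i x v by (simp add: wx V_def scalar_prod_def mat_of_cols_index)
      also have "\<dots> = (\<Sum>j\<in>{0..<k}. v j $ i * y $ j) + (\<Sum>j\<in>{k..<n}. v j $ i * z $ j)"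
        using kn sum.atLeastLessThan_concat[of 0 k n "\<lambda>j. v j $ i * x $ j"]
        by (simp add: y_def z_def)
      also have "(\<Sum>j\<in>{k..<n}. v j $ i * z $ j) = (\<Sum>j\<in>{0..<n}. v j $ i * z $ j)"
        using kn by (intro sum.mono_neutral_left) (auto simp: z_def)
      also have "(\<Sum>j\<in>{0..<k}. v j $ i * y $ j) = (?S *\<^sub>v y) $ i"
        using i y by (simp add: scalar_prod_def mat_of_cols_index)
      also have "?S *\<^sub>v y = P *\<^sub>v (R *\<^sub>v y)"
        unfolding S_eq using assoc_mult_mat_vec[OF Pc R y] .
      also have "(\<Sum>j\<in>{0..<n}. v j $ i * z $ j) = (V *\<^sub>v z) $ i"
        using i z by (simp add: V_def scalar_prod_def mat_of_cols_index)
      finally show "w $ i = (P *\<^sub>v (R *\<^sub>v y) + V *\<^sub>v z) $ i" using i V by simp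
    qed (use V w in simp)
    have XVz: "X *\<^sub>v (V *\<^sub>v z) \<in> carrier_vec n" using X Vz by simp
    have "?S\<^sup>T *\<^sub>v (X *\<^sub>v (V *\<^sub>v z)) = 0\<^sub>v k"
    proof (rule eq_vecI)
      fix i assume "i < dim_vec (0\<^sub>v k :: real vec)"
      then have i: "i < k" by simp
      then have "row ?S\<^sup>T i = row V\<^sup>T i" using kn v V by (simp add: col_V)
      then have "(?S\<^sup>T *\<^sub>v (X *\<^sub>v (V *\<^sub>v z))) $ i = (V\<^sup>T *\<^sub>v (X *\<^sub>v (V *\<^sub>v z))) $ i"
        using i kn V by simp
      also have "V\<^sup>T *\<^sub>v (X *\<^sub>v (V *\<^sub>v z)) = (V\<^sup>T * (X * V)) *\<^sub>v z"
        using V X z by (simp add: assoc_mult_mat_vec[of _ n n _ n])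
      finally show "(?S\<^sup>T *\<^sub>v (X *\<^sub>v (V *\<^sub>v z))) $ i = 0\<^sub>v k $ i"
        using i kn z by (simp add: gram_V z_def)
    qed simp
    then have "P\<^sup>T *\<^sub>v (X *\<^sub>v (V *\<^sub>v z)) = 0\<^sub>v k"
      unfolding P_eq transpose_mult[OF S Q] using S Q XVz
      by (subst assoc_mult_mat_vec[of _ k k _ n]) (auto intro!: eq_vecI)
    then have "proj_wrt X P *\<^sub>v (V *\<^sub>v z) = 0\<^sub>v n"
      using proj_wrt_orthogonal[OF X Pc inv Vz] by simp
    moreover have "proj_wrt X P *\<^sub>v (P *\<^sub>v (R *\<^sub>v y)) = P *\<^sub>v (R *\<^sub>v y)"
      using proj_wrt_range[OF X Pc inv Ry] .
    ultimately have "proj_wrt X P *\<^sub>v w = P *\<^sub>v (R *\<^sub>v y)"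
      unfolding split using proj_wrt_mult_vec(2)[OF X Pc inv Vz] Vz Pc Ry
      by (simp add: mult_add_distrib_mat_vec[of _ n n])
    then have "(1\<^sub>m n - proj_wrt X P) *\<^sub>v w = w - P *\<^sub>v (R *\<^sub>v y)"
      using proj_wrt_mult_vec(2)[OF X Pc inv Vz] w by (simp add: minus_mult_distrib_mat_vec[of _ n n])
    also have "\<dots> = V *\<^sub>v z"
      unfolding split using Vz mult_mat_vec_carrier[OF Pc Ry]
      by (intro eq_vecI) (simp_all del: index_mult_mat_vec dim_mult_mat_vec)
    finally have kap: "kappa A X P w = (\<Sum>i<n. (z $ i)\<^sup>2) / (\<Sum>i<n. lam i * (x $ i)\<^sup>2)"
      using Pc x z by (simp add: kappa_def sq_norm_X) (simp add: wx sq_norm_A)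
    have "lam k * (z $ i)\<^sup>2 \<le> lam i * (x $ i)\<^sup>2" if "i < n" for i
      using mono[of k i] lam_pos[OF that] that by (auto simp: z_def intro: mult_right_mono)
    then have le: "lam k * (\<Sum>i<n. (z $ i)\<^sup>2) \<le> (\<Sum>i<n. lam i * (x $ i)\<^sup>2)"
      unfolding sum_distrib_left by (intro sum_mono) auto
    have "0 < (\<Sum>i<n. lam i * (x $ i)\<^sup>2)"
      using A_pos[OF w w0] sq_norm_A[OF x(1)] by (simp add: sq_norm_wrt_def wx)
    then show ?thesis
      using le lam_pos[OF kn] by (simp add: kap field_simps)
  qed
  then show ?thesis unfolding sup_kappa_def using Pc by (intro SUP_least) auto
qed

end

theorem mainTheorem3:
  fixes n n\<^sub>c :: nat
    and A M Mt P\<^sub>s P\<^sub>f P\<^sub>c P\<^sub>b W\<^sub>b :: "real mat"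
    and lam :: "nat \<Rightarrow> real" and v :: "nat \<Rightarrow> real vec"
    and F C :: "nat set"
  assumes "1 \<le> n\<^sub>c" and "n\<^sub>c < n"
    and "spd_mat n A"
    and "M \<in> carrier_mat n n"
    and "spd_mat n (M + M\<^sup>T - A)"
    and "Mt = M_tilde A M"
    and "\<And>i j. i \<le> j \<Longrightarrow> j < n \<Longrightarrow> lam i \<le> lam j"
    and "\<And>i. i < n \<Longrightarrow> v i \<in> carrier_vec n"
    and "\<And>i. i < n \<Longrightarrow> A *\<^sub>v v i = lam i \<cdot>\<^sub>v (Mt *\<^sub>v v i)"
    and "\<And>i j. i < n \<Longrightarrow> j < n \<Longrightarrow> v i \<bullet> (Mt *\<^sub>v v j) = (if i = j then 1 else 0)"
    and "P\<^sub>s = mat_of_cols n (map v [0..<n\<^sub>c])"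
    and "F \<union> C = {0..<n}" and "F \<inter> C = {}" and "card C = n\<^sub>c"
    and "P\<^sub>f = select_rows F P\<^sub>s" and "P\<^sub>c = select_rows C P\<^sub>s"
    and "invertible_mat P\<^sub>c"
    and "P\<^sub>b = P\<^sub>s * mat_inv P\<^sub>c" and "W\<^sub>b = P\<^sub>f * mat_inv P\<^sub>c"
  shows "FC_order F C P\<^sub>b = W\<^sub>b @\<^sub>r 1\<^sub>m n\<^sub>c
    \<and> is_arg_min (sup_kappa A Mt) (full_rank n n\<^sub>c) P\<^sub>b"
proof -
  interpret pos_generalized_eigenbasis n A Mt lam v
  proof unfold_locales
    show "A \<in> carrier_mat n n" using assms(3) by (simp add: spd_mat_def)
    show "Mt \<in> carrier_mat n n" using assms(4) by (auto simp: assms(6) M_tilde_def)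
    show "\<And>w. w \<in> carrier_vec n \<Longrightarrow> w \<noteq> 0\<^sub>v n \<Longrightarrow> w \<bullet> (A *\<^sub>v w) > 0"
      using assms(3) by (simp add: spd_mat_def)
  qed (fact assms(7-10))+
  have Ps: "P\<^sub>s \<in> carrier_mat n n\<^sub>c"
    using mat_of_cols_carrier(1)[of n "map v [0..<n\<^sub>c]"] by (simp add: assms(11))
  have C: "{i. i < n \<and> i \<in> C} = C" using assms(12) by auto
  have Pc: "P\<^sub>c \<in> carrier_mat n\<^sub>c n\<^sub>c"
    using Ps by (auto simp: assms(14,16) C dim_submatrix)
  note inv = mat_inv_correct[OF Pc assms(17)]
  have Pb: "P\<^sub>b \<in> carrier_mat n n\<^sub>c" using Ps inv(1) by (simp add: assms(18))
  have sel: "select_rows C P\<^sub>b = 1\<^sub>m n\<^sub>c"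
    using select_rows_mult[OF Ps inv(1)] inv(2) by (simp add: assms(16,18))
  have order: "FC_order F C P\<^sub>b = W\<^sub>b @\<^sub>r 1\<^sub>m n\<^sub>c"
    unfolding FC_order_def sel using select_rows_mult[OF Ps inv(1)]
    by (simp add: assms(15,18,19))
  \<comment> \<open>The coarse rows form an identity block, a nonzero minor of order \<open>n\<^sub>c\<close>.\<close>
  have "n\<^sub>c \<le> vec_space.rank n P\<^sub>b"
    using vec_space.rank_gt_minor[OF Pb, of C UNIV] by (simp add: sel)
  then have full: "full_rank n n\<^sub>c P\<^sub>b"
    using Pb assms(2) vec_space.rank_le_nc[OF Pb] by (simp add: full_rank_def)
  have "P\<^sub>s = P\<^sub>b * P\<^sub>c"
    using Ps Pc inv by (simp add: assms(18) assoc_mult_mat[of _ n n\<^sub>c _ n\<^sub>c _ n\<^sub>c])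
  then have "sup_kappa A Mt P\<^sub>b \<le> ereal (1 / lam n\<^sub>c)"
    by (rule sup_kappa_upper[OF full assms(2) inv(1) Pc assms(18)[unfolded assms(11)],
          folded assms(11)])
  then have "is_arg_min (sup_kappa A Mt) (full_rank n n\<^sub>c) P\<^sub>b"
    using full sup_kappa_lower[OF _ assms(2)]
    by (auto simp: is_arg_min_def not_less intro: order_trans)
  then show ?thesis using order by simp
qed

end
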